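(* Let $q$ be an indeterminate. For every integer $m\ge 1$, the following identity holds: $$\sum_{\substack{|\lambda|=2m\\ m_i(\lambda)\text{ even for every even } i}} \frac{1-q^{-\lambda_1'}}{q^{\frac12\sum_{i\ge1}(\lambda_i')^2-\frac{o(\lambda)}{2}}\ \prod_{i\ge1}(1/q^2;1/q^2)_{\lfloor m_i(\lambda)/2\rfloor}} = \frac{1}{q^m}\sum_{i=1}^m\frac{(-1)^{i-1}}{q^{i(i-1)}\,(1/q^2;1/q^2)_{m-i}},$$ where the sum on the left is over all integer partitions $\lambda$ of $2m$ in which every even part size occurs with even multiplicity (possibly zero).
   Context: For a non-negative integer $n$, $(A;Q)_n=\prod_{k=0}^{n-1}(1-AQ^k)$, with $(A;Q)_0=1$. For an integer partition $\lambda$: $|\lambda|$ is its size; $m_i(\lambda)$ is the number of parts of $\lambda$ equal to $i$; $o(\lambda)$ is the number of odd parts of $\lambda$ (counted with multiplicity); $\lambda_i'=\sum_{j\ge i}m_j(\lambda)$, so $\lambda_1'$ is the number of parts of $\lambda$. *)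

theory Defs
  imports
    "HOL-Library.Multiset"
    "HOL-Computational_Algebra.Polynomial"
    "HOL-Computational_Algebra.Fraction_Field"
begin

definition qpochhammer :: "'a::comm_ring_1 \<Rightarrow> 'a \<Rightarrow> nat \<Rightarrow> 'a" where
  "qpochhammer A Q n = (\<Prod>k<n. 1 - A * Q ^ k)"

text \<open>
  An integer partition is the multiset of its (positive) parts; \<open>count \<mu> i\<close> is the
  multiplicity of the part \<open>i\<close> and \<open>sum_mset \<mu>\<close> is the size of \<open>\<mu>\<close>.
\<close>

definition partitions_of :: "nat \<Rightarrow> nat multiset set" where
  "partitions_of n = {\<mu>. 0 \<notin># \<mu> \<and> sum_mset \<mu> = n}"

definition conj_part :: "nat multiset \<Rightarrow> nat \<Rightarrow> nat" where
  "conj_part \<mu> i = (\<Sum>j | j \<in># \<mu> \<and> i \<le> j. count \<mu> j)"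

definition odd_parts :: "nat multiset \<Rightarrow> nat" where
  "odd_parts \<mu> = size {# i \<in># \<mu>. odd i #}"

text \<open>
  All \<open>\<mu>'\<^sub>i\<close> with \<open>i > |\<mu>|\<close> vanish, so the finite range below
  covers the whole sum over \<open>i \<ge> 1\<close>. The division by 2 is exact, see
  \<open>two_dvd_exponent\<close>.
\<close>

definition half_exponent :: "nat multiset \<Rightarrow> int" where
  "half_exponent \<mu> =
     ((\<Sum>i = 1..sum_mset \<mu>. int (conj_part \<mu> i) ^ 2) - int (odd_parts \<mu>)) div 2"

text \<open>The indeterminate \<open>q\<close> of the field of rational functions over the rationals.\<close>

definition qvar :: "rat poly fract" where
  "qvar = Fract [:0, 1:] 1"

lemma conj_part_eq_size: "conj_part \<mu> i = size {# j \<in># \<mu>. i \<le> j #}"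
proof -
  have "{j. j \<in># \<mu> \<and> i \<le> j} = set_mset {# j \<in># \<mu>. i \<le> j #}" by auto
  then show ?thesis
    unfolding conj_part_def size_multiset_overloaded_eq
    by (intro sum.cong) auto
qed

lemma part_le_size: "j \<in># \<mu> \<Longrightarrow> j \<le> sum_mset \<mu>" for j :: nat
  by (auto dest!: multi_member_split)

lemma conj_part_eq_0:
  assumes "sum_mset \<mu> < i"
  shows "conj_part \<mu> i = 0"
proof -
  have "\<not> i \<le> j" if "j \<in># \<mu>" for j
    using part_le_size[OF that] assms by simp
  then have "{# j \<in># \<mu>. i \<le> j #} = {#}" by simp
  then show ?thesis unfolding conj_part_eq_size by simp
qed

lemma sum_conj_part:
  assumes "sum_mset \<mu> \<le> N"
  shows "(\<Sum>i = 1..N. conj_part \<mu> i) = sum_mset \<mu>"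
  using assms
proof (induction \<mu>)
  case empty
  then show ?case by (simp add: conj_part_def)
next
  case (add x \<mu>)
  have "(\<Sum>i = 1..N. conj_part (add_mset x \<mu>) i)
        = (\<Sum>i = 1..N. conj_part \<mu> i + (if i \<le> x then 1 else 0))"
    by (intro sum.cong) (auto simp: conj_part_eq_size)
  also have "\<dots> = sum_mset \<mu> + card {i \<in> {1..N}. i \<le> x}"
    using add by (simp add: sum.distrib sum.If_cases Int_def)
  also have "{i \<in> {1..N}. i \<le> x} = {1..x}"
    using add.prems by auto
  finally show ?case by simp
qed

lemma even_odd_parts_iff: "even (odd_parts \<mu>) \<longleftrightarrow> even (sum_mset \<mu>)"
  by (induction \<mu>) (auto simp: odd_parts_def)

lemma two_dvd_exponent:
  "2 dvd (\<Sum>i = 1..sum_mset \<mu>. int (conj_part \<mu> i) ^ 2) - int (odd_parts \<mu>)"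
proof -
  have "even (\<Sum>i\<in>A. int (conj_part \<mu> i) ^ 2) \<longleftrightarrow> even (\<Sum>i\<in>A. conj_part \<mu> i)"
    if "finite A" for A
    using that by (induction A) auto
  then show ?thesis
    using sum_conj_part[of \<mu> "sum_mset \<mu>"] even_odd_parts_iff[of \<mu>] by simp
qed

lemma finite_partitions_of: "finite (partitions_of n)"
proof -
  have size: "size \<mu> \<le> sum_mset \<mu>" if "0 \<notin># \<mu>" for \<mu> :: "nat multiset"
    using that
  proof (induction \<mu>)
    case (add x \<mu>)
    then have "x \<ge> 1" and "size \<mu> \<le> sum_mset \<mu>" by auto
    then show ?case by simp
  qed simp
  have "partitions_of n \<subseteq> mset ` {xs. set xs \<subseteq> {..n} \<and> length xs \<le> n}"
  proof
    fix \<mu> assume "\<mu> \<in> partitions_of n"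
    then have *: "0 \<notin># \<mu>" "sum_mset \<mu> = n" by (simp_all add: partitions_of_def)
    obtain xs where xs: "mset xs = \<mu>" by (metis ex_mset)
    have "length xs \<le> n" using size[OF *(1)] *(2) xs[symmetric] by simp
    moreover have "set xs \<subseteq> {..n}"
      using part_le_size[of _ \<mu>] *(2) xs[symmetric] by auto
    ultimately show "\<mu> \<in> mset ` {xs. set xs \<subseteq> {..n} \<and> length xs \<le> n}"
      using xs by blast
  qed
  then show ?thesis
    by (rule finite_subset) (intro finite_imageI finite_lists_length_le finite_atMost)
qed

end

theory Submission
  imports Defs
begin

text \<open>
  Put \<open>t = 1 / q\<close>, \<open>Q = t\<^sup>2\<close>, and write \<open>(Q)_n\<close> for \<open>(Q; Q)_n\<close> and \<open>[n, k]\<close> for the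
  Gaussian binomial coefficient in \<open>Q\<close>. Since the number of odd parts is
  \<open>\<lambda>'\<^sub>1 - \<lambda>'\<^sub>2 + \<lambda>'\<^sub>3 - \<dots>\<close>, the exponent on the left is the sum of the binomial coefficients
  \<open>\<lambda>'\<^sub>i choose 2\<close> for odd \<open>i\<close> and \<open>(\<lambda>'\<^sub>i + 1) choose 2\<close> for even \<open>i\<close>. Removing the first column
  of the Young diagram of \<open>\<lambda>\<close> shifts every part by one and so exchanges the two parities: the
  partitions whose even parts have even multiplicity (the orthogonal type) and those whose odd
  parts have even multiplicity (the symplectic type), with the roles of odd and even \<open>i\<close> in the
  exponent exchanged as well, feed into each other.

  Let \<open>O(n, k)\<close> and \<open>S(n, k)\<close> be the sums of the weights (the summands without the numerator
  \<open>1 - t ^ \<lambda>'\<^sub>1\<close>) over the partitions of \<open>n\<close> into \<open>k\<close> parts of the two types. Column removal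
  gives a recurrence for each in terms of the other (lemma \<open>weight_sum_rec\<close>). Its solution is a
  product formula (lemma \<open>weight_sum_closed\<close>); the one that matters in the end is
  \<open>O(2 m, 2 h) = t ^ m * Q ^ (h * (h - 1)) * [m - 1, h - 1] / (Q)_h\<close>.
  The induction works because \<open>S(2 m, 2 h) + S(2 m, 2 h - 1) = O(2 m, 2 h)\<close>, which collapses the
  recurrence for \<open>O\<close> to a \<open>q\<close>-Vandermonde sum (lemma \<open>column_sum\<close>); the other three recurrences
  reduce to the same sum.

  As \<open>O(2 m, k) = 0\<close> for odd \<open>k\<close> and \<open>1 - t ^ (2 * h) = 1 - Q ^ h\<close>, the left-hand side becomes
  \<open>t ^ m\<close> times the sum over \<open>h\<close> of \<open>Q ^ (h * (h - 1)) * [m - 1, h - 1] / (Q)_(h - 1)\<close>. This sum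
  and the alternating sum on the right obey the same first-order recurrence in \<open>m\<close>
  (lemma \<open>alternating_sum\<close>).
\<close>

section \<open>Gaussian binomial coefficients\<close>

fun qbinom :: "'a::comm_ring_1 \<Rightarrow> nat \<Rightarrow> nat \<Rightarrow> 'a" where
  "qbinom Q n 0 = 1"
| "qbinom Q 0 (Suc k) = 0"
| "qbinom Q (Suc n) (Suc k) = qbinom Q n k + Q ^ Suc k * qbinom Q n (Suc k)"

abbreviation qfact :: "'a::comm_ring_1 \<Rightarrow> nat \<Rightarrow> 'a" where
  "qfact Q n \<equiv> qpochhammer Q Q n"

lemma qfact_0 [simp]: "qfact Q 0 = 1"
  by (simp add: qpochhammer_def)

lemma qfact_Suc: "qfact Q (Suc n) = (1 - Q ^ Suc n) * qfact Q n"
  by (simp add: qpochhammer_def)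

lemma qfact_nonzero:
  fixes Q :: "'a::field"
  assumes "\<forall>k>0. Q ^ k \<noteq> 1"
  shows "qfact Q n \<noteq> 0"
  by (induction n) (use assms in \<open>auto simp: qfact_Suc simp del: power_Suc\<close>)

lemma qbinom_eq_0: "n < k \<Longrightarrow> qbinom Q n k = 0"
  by (induction Q n k rule: qbinom.induct) auto

lemma qbinom_self [simp]: "qbinom Q n n = 1"
  by (induction n) (auto simp: qbinom_eq_0)

lemma qbinom_qfact: "qbinom Q (a + b) a * qfact Q a * qfact Q b = qfact Q (a + b)"
proof (induction "a + b" arbitrary: a b)
  case 0
  then show ?case by simp
next
  case (Suc n)
  consider "a = 0" | "b = 0" | a' b' where "a = Suc a'" "b = Suc b'"
    by (metis not0_implies_Suc)
  then show ?case
  proof cases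
    case 3
    have n: "n = a' + Suc b'" using Suc.hyps(2) 3 by simp
    have 1: "qbinom Q (a' + Suc b') a' * qfact Q a' * qfact Q (Suc b') = qfact Q (a' + Suc b')"
      by (rule Suc.hyps(1)[OF n])
    have 2: "qbinom Q (Suc a' + b') (Suc a') * qfact Q (Suc a') * qfact Q b' = qfact Q (Suc a' + b')"
      by (rule Suc.hyps(1)) (use n in simp)
    have "qbinom Q (a + b) a * qfact Q a * qfact Q b
        = (1 - Q ^ Suc a') * (qbinom Q (a' + Suc b') a' * qfact Q a' * qfact Q (Suc b'))
          + Q ^ Suc a' * (1 - Q ^ Suc b') * (qbinom Q (Suc a' + b') (Suc a') * qfact Q (Suc a') * qfact Q b')"
      using 3 by (simp add: qfact_Suc algebra_simps)
    also have "\<dots> = (1 - Q ^ Suc a' + Q ^ Suc a' * (1 - Q ^ Suc b')) * qfact Q (Suc (a' + b'))"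
      unfolding 1 2 by (simp add: algebra_simps)
    also have "\<dots> = (1 - Q ^ Suc (Suc (a' + b'))) * qfact Q (Suc (a' + b'))"
      by (simp add: algebra_simps power_add)
    also have "\<dots> = qfact Q (a + b)"
      using 3 by (simp add: qfact_Suc)
    finally show ?thesis .
  qed auto
qed

lemma qbinom_eq_quotient:
  fixes Q :: "'a::field"
  assumes "\<forall>k>0. Q ^ k \<noteq> 1"
  shows "qbinom Q (a + b) a = qfact Q (a + b) / (qfact Q a * qfact Q b)"
  using qbinom_qfact[of Q a b] qfact_nonzero[OF assms] by (simp add: field_simps)

text \<open>
  Expanding the Gaussian binomial by its Pascal rule moves one unit from its upper index into the
  shift \<open>r\<close>. The exponent \<open>j * (j + r)\<close> is what makes this possible:
  \<open>(j + 1) * (j + 1 + r) = j * (j + r + 1) + (j + r + 1)\<close>, so both halves of the Pascal rule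
  produce the factor \<open>Q ^ (j * (j + r + 1))\<close>. Any sequence \<open>A\<close> with a Pascal-like rule can
  thus be summed by iteration.
\<close>

lemma sum_qbinom_step:
  assumes AB: "\<And>r. A r + Q ^ Suc r * A (Suc r) = B (Suc r)"
  shows "(\<Sum>j\<le>Suc N. Q ^ (j * (j + r)) * qbinom Q (Suc N) j * A (j + r))
       = (\<Sum>j\<le>N. Q ^ (j * (j + Suc r)) * qbinom Q N j * B (j + Suc r))"
proof -
  let ?u = "\<lambda>j. Q ^ (j * (j + Suc r)) * qbinom Q N j"
  have "(\<Sum>j\<le>Suc N. Q ^ (j * (j + r)) * qbinom Q (Suc N) j * A (j + r))
      = A r + (\<Sum>j\<le>N. ?u j * Q ^ Suc (j + r) * A (Suc (j + r)) + ?u (Suc j) * A (Suc (j + r)))"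
    by (subst sum.atMost_Suc_shift)
       (auto intro!: sum.cong simp: algebra_simps power_add)
  also have "\<dots> = (\<Sum>j\<le>N. ?u j * Q ^ Suc (j + r) * A (Suc (j + r)))
                 + (\<Sum>j\<le>Suc N. ?u j * A (j + r))"
    unfolding sum.atMost_Suc_shift[of "\<lambda>j. ?u j * A (j + r)"]
    by (simp add: sum.distrib add.left_commute del: qbinom.simps(3))
  also have "(\<Sum>j\<le>Suc N. ?u j * A (j + r)) = (\<Sum>j\<le>N. ?u j * A (j + r))"
    by (simp add: qbinom_eq_0)
  also have "(\<Sum>j\<le>N. ?u j * Q ^ Suc (j + r) * A (Suc (j + r))) + \<dots>
      = (\<Sum>j\<le>N. ?u j * (A (j + r) + Q ^ Suc (j + r) * A (Suc (j + r))))"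
    by (simp add: sum.distrib[symmetric] algebra_simps)
  also have "\<dots> = (\<Sum>j\<le>N. ?u j * B (j + Suc r))"
    by (simp only: AB add_Suc_right)
  finally show ?thesis .
qed

lemma q_vandermonde:
  "(\<Sum>j\<le>N. Q ^ (j * (j + r)) * qbinom Q N j * qbinom Q n (j + r)) = qbinom Q (n + N) (r + N)"
proof (induction N arbitrary: n r)
  case (Suc N)
  have "(\<Sum>j\<le>Suc N. Q ^ (j * (j + r)) * qbinom Q (Suc N) j * qbinom Q n (j + r))
      = (\<Sum>j\<le>N. Q ^ (j * (j + Suc r)) * qbinom Q N j * qbinom Q (Suc n) (j + Suc r))"
    by (rule sum_qbinom_step) simp
  then show ?case by (simp only: Suc.IH) simp
qed simp

text \<open>
  Classifying partitions by the largest rectangle of size \<open>j\<close> by \<open>j + r\<close> in their diagram, a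
  variant of the Durfee square, explains the identity. It is also the limit of \<open>q_vandermonde\<close>
  for \<open>n\<close> going to infinity.
\<close>

lemma durfee_sum:
  fixes Q :: "'a::field"
  assumes nz: "\<forall>k>0. Q ^ k \<noteq> 1"
  shows "(\<Sum>j\<le>N. Q ^ (j * (j + r)) * qbinom Q N j / qfact Q (j + r)) = 1 / qfact Q (r + N)"
proof (induction N arbitrary: r)
  case (Suc N)
  have "(\<Sum>j\<le>Suc N. Q ^ (j * (j + r)) * qbinom Q (Suc N) j * (1 / qfact Q (j + r)))
      = (\<Sum>j\<le>N. Q ^ (j * (j + Suc r)) * qbinom Q N j * (1 / qfact Q (j + Suc r)))"
  proof (rule sum_qbinom_step)
    fix r
    show "1 / qfact Q r + Q ^ Suc r * (1 / qfact Q (Suc r)) = 1 / qfact Q (Suc r)"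
      using qfact_nonzero[OF nz] nz[rule_format, of "Suc r"]
      by (simp add: qfact_Suc divide_simps del: power_Suc)
  qed
  then show ?case using Suc.IH[of "Suc r"] by simp
qed simp

text \<open>
  The form of the \<open>q\<close>-Vandermonde identity that comes up when a column of a partition is removed:
  \<open>h - i\<close> is half the multiplicity of the part 1, rounded down.
\<close>

lemma column_sum:
  fixes Q :: "'a::field"
  assumes nz: "\<forall>k>0. Q ^ k \<noteq> 1"
  shows "(\<Sum>i\<le>h. Q ^ (i * (i + r)) * qbinom Q N i / (qfact Q (i + r) * qfact Q (h - i)))
       = qbinom Q (N + h + r) h / qfact Q (h + r)"
proof -
  let ?f = "\<lambda>i. Q ^ (i * (i + r)) * qbinom Q N i * qbinom Q (h + r) (i + r)"
  have "qbinom Q (h + r) (i + r) = qfact Q (h + r) / (qfact Q (i + r) * qfact Q (h - i))"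
    if "i \<le> h" for i
    using qbinom_eq_quotient[OF nz, of "i + r" "h - i"] that by (simp add: add.commute)
  then have "(\<Sum>i\<le>h. Q ^ (i * (i + r)) * qbinom Q N i / (qfact Q (i + r) * qfact Q (h - i)))
      = (\<Sum>i\<le>h. ?f i) / qfact Q (h + r)"
    using qfact_nonzero[OF nz] by (simp add: sum_divide_distrib)
  also have "(\<Sum>i\<le>h. ?f i) = (\<Sum>i\<le>N. ?f i)"
    by (rule trans[OF sum.mono_neutral_left sum.mono_neutral_right, of "{..max h N}"])
       (auto simp: qbinom_eq_0)
  also have "\<dots> = qbinom Q (h + r + N) (r + N)"
    by (rule q_vandermonde)
  also have "\<dots> = qbinom Q (N + h + r) h"
    using qbinom_eq_quotient[OF nz, of "r + N" h] qbinom_eq_quotient[OF nz, of h "r + N"]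
    by (simp add: ac_simps)
  finally show ?thesis .
qed

text \<open>
  Both sides \<open>X M\<close> satisfy \<open>X (M + 1) = (1 - Q ^ (M + 1)) * X M + Q ^ (M + 1) / (Q)_(M + 1)\<close>.
  On the left, the error term is the case \<open>r = 0\<close> of \<open>durfee_sum\<close>; on the right, it is
  what remains after a telescoping.
\<close>

lemma alternating_sum:
  fixes Q :: "'a::field"
  assumes nz: "\<forall>k>0. Q ^ k \<noteq> 1"
  shows "(\<Sum>j\<le>M. Q ^ (j * (j + 1)) * qbinom Q M j / qfact Q j)
       = (\<Sum>i\<le>M. (- 1) ^ i * Q ^ (Suc i choose 2) / qfact Q (M - i))"
proof (induction M)
  case 0
  then show ?case by (simp add: numeral_2_eq_2)
next
  case (Suc M)
  note nz' = qfact_nonzero[OF nz]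
  let ?T = "\<lambda>M. \<Sum>j\<le>M. Q ^ (j * (j + 1)) * qbinom Q M j / qfact Q j"
  let ?R = "\<lambda>M. \<Sum>i\<le>M. (- 1) ^ i * Q ^ (Suc i choose 2) / qfact Q (M - i)"
  \<comment> \<open>The first-order recurrence for the left-hand side.\<close>
  have absorb: "(1 - Q ^ Suc M) * qbinom Q M j = (1 - Q ^ (Suc M - j)) * qbinom Q (Suc M) j"
    if "j \<le> M" for j
  proof -
    have e1: "qbinom Q (Suc M) j = qfact Q (Suc M) / (qfact Q j * qfact Q (Suc (M - j)))"
      using qbinom_eq_quotient[OF nz, of j "Suc (M - j)"] that by simp
    have e2: "qbinom Q M j = qfact Q M / (qfact Q j * qfact Q (M - j))"
      using qbinom_eq_quotient[OF nz, of j "M - j"] that by simp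
    show ?thesis
      unfolding e1 e2 using nz' nz[rule_format, of "Suc (M - j)"] that
      by (simp add: qfact_Suc Suc_diff_le del: power_Suc)
  qed
  have "(1 - Q ^ Suc M) * ?T M
      = (\<Sum>j\<le>M. Q ^ (j * (j + 1)) * ((1 - Q ^ Suc M) * qbinom Q M j) / qfact Q j)"
    by (simp add: sum_distrib_left algebra_simps)
  also have "\<dots> = (\<Sum>j\<le>Suc M. Q ^ (j * (j + 1)) * ((1 - Q ^ (Suc M - j)) * qbinom Q (Suc M) j) / qfact Q j)"
    by (simp add: absorb del: power_Suc qbinom.simps)
  also have "\<dots> = (\<Sum>j\<le>Suc M. Q ^ (j * (j + 1)) * qbinom Q (Suc M) j / qfact Q j
       - Q ^ Suc M * (Q ^ (j * (j + 0)) * qbinom Q (Suc M) j / qfact Q (j + 0)))"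
  proof (rule sum.cong[OF refl])
    fix j assume "j \<in> {..Suc M}"
    then have "Q ^ (j * (j + 1)) * Q ^ (Suc M - j) = Q ^ Suc M * Q ^ (j * (j + 0))"
      by (simp add: power_add[symmetric] add.commute del: power_Suc)
    then show "Q ^ (j * (j + 1)) * ((1 - Q ^ (Suc M - j)) * qbinom Q (Suc M) j) / qfact Q j
      = Q ^ (j * (j + 1)) * qbinom Q (Suc M) j / qfact Q j
       - Q ^ Suc M * (Q ^ (j * (j + 0)) * qbinom Q (Suc M) j / qfact Q (j + 0))"
      by (simp add: left_diff_distrib right_diff_distrib diff_divide_distrib mult.assoc[symmetric]
           del: power_Suc qbinom.simps)
  qed
  also have "\<dots> = ?T (Suc M) - Q ^ Suc M / qfact Q (Suc M)"
    unfolding sum_subtractf sum_distrib_left[symmetric] durfee_sum[OF nz]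
    by (simp only: add_0 times_divide_eq_right mult_1_right)
  finally have T: "?T (Suc M) = (1 - Q ^ Suc M) * ?T M + Q ^ Suc M / qfact Q (Suc M)"
    by simp
  \<comment> \<open>The recurrence for the right-hand side: the index shift \<open>i \<mapsto> i + 1\<close> turns the sum of \<open>?s\<close>
      into \<open>1 / (Q)_(M + 1) - ?R M\<close>.\<close>
  let ?s = "\<lambda>i. (- 1) ^ i * Q ^ (i choose 2) / qfact Q (Suc M - i)"
  have tri: "Q ^ (Suc i choose 2) = Q ^ i * Q ^ (i choose 2)" for i
    by (simp add: power_add[symmetric] numeral_2_eq_2)
  have split: "(- 1) ^ i * Q ^ (Suc i choose 2) / qfact Q (Suc M - i)
      = (if i \<le> M then (- 1) ^ i * Q ^ (Suc i choose 2) / qfact Q (M - i) else 0)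
        + Q ^ Suc M * ?s i" if "i \<le> Suc M" for i
  proof (cases "i \<le> M")
    case True
    have "Q ^ Suc M = Q ^ Suc (M - i) * Q ^ i"
      using True by (simp add: power_add[symmetric] del: power_Suc)
    with True show ?thesis
      using nz' nz[rule_format, of "Suc (M - i)"]
      by (simp add: qfact_Suc Suc_diff_le tri field_simps del: power_Suc)
  next
    case False
    with that have "i = Suc M" by simp
    then show ?thesis by (simp only: tri) simp
  qed
  have "?R (Suc M) = (\<Sum>i\<le>Suc M. (if i \<le> M then (- 1) ^ i * Q ^ (Suc i choose 2) / qfact Q (M - i) else 0)
        + Q ^ Suc M * ?s i)"
    by (rule sum.cong[OF refl], rule split) simp
  also have "\<dots> = ?R M + Q ^ Suc M * (\<Sum>i\<le>Suc M. ?s i)"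
    by (simp only: sum.distrib sum_distrib_left[symmetric]) simp
  also have "(\<Sum>i\<le>Suc M. ?s i) = 1 / qfact Q (Suc M) - ?R M"
    by (subst sum.atMost_Suc_shift) (simp add: sum_negf[symmetric] numeral_2_eq_2)
  finally have "?R (Suc M) = (1 - Q ^ Suc M) * ?R M + Q ^ Suc M / qfact Q (Suc M)"
    by (simp add: algebra_simps)
  then show ?case using T Suc.IH by simp
qed

section \<open>Removing the first column of a partition\<close>

definition parts_level :: "nat \<Rightarrow> nat \<Rightarrow> nat multiset set" where
  "parts_level n k = {\<mu> \<in> partitions_of n. size \<mu> = k}"

text \<open>
  The flag \<open>b\<close> tells the two types apart: \<open>True\<close> is the orthogonal type, where the even
  parts are constrained, and \<open>False\<close> the symplectic type, where the odd parts are. Adding or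
  removing a column negates it.
\<close>

definition admissible :: "bool \<Rightarrow> nat multiset \<Rightarrow> bool" where
  "admissible b \<mu> \<longleftrightarrow> (\<forall>i. even i = b \<longrightarrow> even (count \<mu> i))"

text \<open>
  For \<open>b = True\<close> this is \<open>half_exponent\<close>, see \<open>half_exponent_eq\<close>. For \<open>b = False\<close> it is the
  exponent with the number of odd parts added instead of subtracted.
\<close>

definition col_exp :: "bool \<Rightarrow> nat multiset \<Rightarrow> nat" where
  "col_exp b \<mu> = (\<Sum>i = 1..sum_mset \<mu>. (conj_part \<mu> i + of_bool (even i = b)) choose 2)"

definition mult_prod :: "'a::field \<Rightarrow> nat multiset \<Rightarrow> 'a" where
  "mult_prod Q \<mu> = (\<Prod>i\<in>set_mset \<mu>. qfact Q (count \<mu> i div 2))"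

definition weight_sum :: "'a::field \<Rightarrow> bool \<Rightarrow> nat \<Rightarrow> nat \<Rightarrow> 'a" where
  "weight_sum t b n k =
     (\<Sum>\<mu> | \<mu> \<in> parts_level n k \<and> admissible b \<mu>. t ^ col_exp b \<mu> / mult_prod (t\<^sup>2) \<mu>)"

text \<open>
  Seen as a partition into exactly \<open>k\<close> parts, zero allowed, \<open>\<mu>\<close> has all its parts raised by one.
\<close>

definition add_column :: "nat \<Rightarrow> nat multiset \<Rightarrow> nat multiset" where
  "add_column k \<mu> = image_mset Suc \<mu> + replicate_mset (k - size \<mu>) 1"

lemma size_le_sum_mset: "0 \<notin># \<mu> \<Longrightarrow> size \<mu> \<le> sum_mset \<mu>" for \<mu> :: "nat multiset"
proof (induction \<mu>)
  case (add x \<mu>)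
  then have "x \<noteq> 0" "size \<mu> \<le> sum_mset \<mu>" by auto
  then show ?case by simp
qed simp

lemma conj_part_1: "0 \<notin># \<mu> \<Longrightarrow> conj_part \<mu> 1 = size \<mu>"
  unfolding conj_part_eq_size
  by (rule arg_cong[of _ _ size], induction \<mu>) auto

lemma finite_parts_level [simp]: "finite (parts_level n k)"
  using finite_partitions_of by (simp add: parts_level_def)

lemma parts_level_empty: "n < k \<Longrightarrow> parts_level n k = {}"
  using size_le_sum_mset by (fastforce simp: parts_level_def partitions_of_def)

lemma parts_level_0: "parts_level n 0 = (if n = 0 then {{#}} else {})"
  by (auto simp: parts_level_def partitions_of_def)

lemma size_add_column: "size \<mu> \<le> k \<Longrightarrow> size (add_column k \<mu>) = k"
  by (simp add: add_column_def)

lemma zero_notin_add_column: "0 \<notin># add_column k \<mu>"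
  by (auto simp: add_column_def)

lemma sum_add_column: "size \<mu> \<le> k \<Longrightarrow> sum_mset (add_column k \<mu>) = sum_mset \<mu> + k"
proof -
  have "sum_mset (image_mset Suc \<mu>) = sum_mset \<mu> + size \<mu>" by (induction \<mu>) auto
  then show "size \<mu> \<le> k \<Longrightarrow> ?thesis" by (simp add: add_column_def sum_mset_replicate_mset)
qed

lemma count_image_Suc: "count (image_mset Suc \<mu>) i = (if i = 0 then 0 else count \<mu> (i - 1))"
  by (induction \<mu>) auto

lemma count_add_column_1:
  "0 \<notin># \<mu> \<Longrightarrow> count (add_column k \<mu>) 1 = k - size \<mu>"
  by (simp add: add_column_def count_image_Suc not_in_iff)

lemma count_add_column_Suc:
  "i > 0 \<Longrightarrow> count (add_column k \<mu>) (Suc i) = count \<mu> i"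
  by (simp add: add_column_def count_image_Suc)

lemma conj_part_add_column_Suc:
  assumes "i > 0"
  shows "conj_part (add_column k \<mu>) (Suc i) = conj_part \<mu> i"
proof -
  have "filter_mset (\<lambda>j. Suc i \<le> j) (image_mset Suc \<mu>) = image_mset Suc (filter_mset (\<lambda>j. i \<le> j) \<mu>)"
    by (induction \<mu>) auto
  moreover have "size (filter_mset (\<lambda>j. Suc i \<le> j) (replicate_mset n 1)) = 0" for n
    using assms by (induction n) auto
  ultimately show ?thesis
    by (simp only: conj_part_eq_size add_column_def filter_union_mset size_union) simp
qed

lemma admissible_add_column:
  assumes "0 \<notin># \<mu>"
  shows "admissible b (add_column k \<mu>) \<longleftrightarrow> admissible (\<not> b) \<mu> \<and> (b \<or> even (k - size \<mu>))"
proof -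
  let ?P = "\<lambda>i. even i = b \<longrightarrow> even (count (add_column k \<mu>) i)"
  have split: "(\<forall>i. P i) \<longleftrightarrow> P 0 \<and> P 1 \<and> (\<forall>i>0. P (Suc i))" for P :: "nat \<Rightarrow> bool"
  proof (intro iffI allI)
    fix i assume "P 0 \<and> P 1 \<and> (\<forall>i>0. P (Suc i))"
    then show "P i" by (cases i; cases "i = 1") auto
  qed auto
  have "admissible b (add_column k \<mu>) \<longleftrightarrow> ?P 0 \<and> ?P 1 \<and> (\<forall>i>0. ?P (Suc i))"
    unfolding admissible_def by (rule split)
  moreover have "?P 0"
    using zero_notin_add_column[of k \<mu>] by (simp add: not_in_iff)
  moreover have "?P 1 \<longleftrightarrow> b \<or> even (k - size \<mu>)"
    unfolding count_add_column_1[OF assms] by auto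
  moreover have "(\<forall>i>0. ?P (Suc i)) \<longleftrightarrow> admissible (\<not> b) \<mu>"
  proof -
    have "(even i = (\<not> b) \<longrightarrow> even (count \<mu> i)) \<longleftrightarrow> (i > 0 \<longrightarrow> ?P (Suc i))" for i
      using assms by (cases "i = 0") (auto simp: count_add_column_Suc not_in_iff)
    then show ?thesis unfolding admissible_def by blast
  qed
  ultimately show ?thesis by auto
qed

lemma col_exp_extend:
  assumes "sum_mset \<mu> \<le> N"
  shows "col_exp b \<mu> = (\<Sum>i = 1..N. (conj_part \<mu> i + of_bool (even i = b)) choose 2)"
  unfolding col_exp_def using assms
  by (intro sum.mono_neutral_left) (auto simp: conj_part_eq_0 numeral_2_eq_2)

lemma col_exp_add_column:
  assumes "0 \<notin># \<mu>" "size \<mu> \<le> k" "k > 0"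
  shows "col_exp b (add_column k \<mu>) = ((k + of_bool (\<not> b)) choose 2) + col_exp (\<not> b) \<mu>"
proof -
  let ?c = "\<lambda>i. (conj_part (add_column k \<mu>) i + of_bool (even i = b)) choose 2"
  have shift: "(\<Sum>i = 1..Suc n. c i) = c 1 + (\<Sum>i = 1..n. c (Suc i))" for c :: "nat \<Rightarrow> nat" and n
    by (induction n) auto
  have "col_exp b (add_column k \<mu>) = (\<Sum>i = 1..Suc (sum_mset \<mu> + k - 1). ?c i)"
    using assms by (simp add: col_exp_def sum_add_column)
  also have "\<dots> = ?c 1 + (\<Sum>i = 1..sum_mset \<mu> + k - 1. ?c (Suc i))"
    by (rule shift)
  also have "?c 1 = (k + of_bool (\<not> b)) choose 2"
    using assms zero_notin_add_column by (subst conj_part_1) (auto simp: size_add_column)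
  also have "(\<Sum>i = 1..sum_mset \<mu> + k - 1. ?c (Suc i)) = col_exp (\<not> b) \<mu>"
    using assms by (subst col_exp_extend[of _ "sum_mset \<mu> + k - 1"])
      (auto intro!: sum.cong simp: conj_part_add_column_Suc)
  finally show ?thesis .
qed

lemma mult_prod_extend:
  assumes "finite A" "set_mset \<mu> \<subseteq> A"
  shows "mult_prod Q \<mu> = (\<Prod>i\<in>A. qfact Q (count \<mu> i div 2))"
  unfolding mult_prod_def using assms
  by (intro prod.mono_neutral_left) (auto simp: not_in_iff)

lemma mult_prod_add_column:
  assumes "0 \<notin># \<mu>"
  shows "mult_prod Q (add_column k \<mu>) = qfact Q ((k - size \<mu>) div 2) * mult_prod Q \<mu>"
proof -
  have sub: "set_mset (add_column k \<mu>) \<subseteq> insert 1 (Suc ` set_mset \<mu>)"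
    by (auto simp: add_column_def)
  have "mult_prod Q (add_column k \<mu>)
      = (\<Prod>i\<in>insert 1 (Suc ` set_mset \<mu>). qfact Q (count (add_column k \<mu>) i div 2))"
    by (rule mult_prod_extend[OF _ sub]) simp
  also have "\<dots> = qfact Q ((k - size \<mu>) div 2) *
      (\<Prod>i\<in>set_mset \<mu>. qfact Q (count (add_column k \<mu>) (Suc i) div 2))"
    using assms by (subst prod.insert) (auto simp: count_add_column_1[simplified] prod.reindex)
  also have "(\<Prod>i\<in>set_mset \<mu>. qfact Q (count (add_column k \<mu>) (Suc i) div 2)) = mult_prod Q \<mu>"
    unfolding mult_prod_def using assms
    by (intro prod.cong refl) (metis count_add_column_Suc gr0I)
  finally show ?thesis .
qed

lemma bij_betw_add_column:
  assumes "k \<le> n"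
  shows "bij_betw (add_column k) {\<mu> \<in> partitions_of (n - k). size \<mu> \<le> k} (parts_level n k)"
proof (rule bij_betw_byWitness)
  let ?rem = "\<lambda>\<mu>. filter_mset (\<lambda>i. i > 0) (image_mset (\<lambda>i. i - 1) \<mu>)"
  have "filter_mset (\<lambda>i. i > 0) \<mu> = \<mu>" if "0 \<notin># \<mu>" for \<mu> :: "nat multiset"
    using that by (induction \<mu>) auto
  moreover have "filter_mset (\<lambda>i. i > 0) (\<mu> + replicate_mset l 0) = filter_mset (\<lambda>i. i > 0) \<mu>"
    for \<mu> :: "nat multiset" and l
    by (induction l) (simp_all del: filter_union_mset)
  ultimately show "\<forall>\<mu>\<in>{\<mu> \<in> partitions_of (n - k). size \<mu> \<le> k}. ?rem (add_column k \<mu>) = \<mu>"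
    by (simp add: add_column_def partitions_of_def image_mset.compositionality comp_def
          del: filter_union_mset)
  have rem: "size \<mu> = size (?rem \<mu>) + count \<mu> 1 \<and> add_column (size \<mu>) (?rem \<mu>) = \<mu>"
    if "0 \<notin># \<mu>" for \<mu>
  proof -
    have "size \<mu> = size (?rem \<mu>) + count \<mu> 1 \<and>
          image_mset Suc (?rem \<mu>) + replicate_mset (count \<mu> 1) 1 = \<mu>"
      using that
    proof (induction \<mu>)
      case (add x \<mu>)
      have IH: "size \<mu> = size (?rem \<mu>) + count \<mu> 1"
          "image_mset Suc (?rem \<mu>) + replicate_mset (count \<mu> 1) 1 = \<mu>"
        using add by auto
      from add.prems consider "x = 1" | "x > 1" by fastforce
      then show ?case
      proof cases
        case 1
        then show ?thesis using IH by simp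
      next
        case 2
        then show ?thesis using IH by simp
      qed
    qed simp
    then show ?thesis unfolding add_column_def by (metis add_diff_cancel_left')
  qed
  show "\<forall>\<mu>\<in>parts_level n k. add_column k (?rem \<mu>) = \<mu>"
    using rem by (auto simp: parts_level_def partitions_of_def)
  show "add_column k ` {\<mu> \<in> partitions_of (n - k). size \<mu> \<le> k} \<subseteq> parts_level n k"
    using assms zero_notin_add_column
    by (auto simp: parts_level_def partitions_of_def sum_add_column size_add_column)
  show "?rem ` parts_level n k \<subseteq> {\<mu> \<in> partitions_of (n - k). size \<mu> \<le> k}"
  proof clarify
    fix \<mu> assume "\<mu> \<in> parts_level n k"
    then have \<mu>: "0 \<notin># \<mu>" "sum_mset \<mu> = n" "size \<mu> = k"
      by (auto simp: parts_level_def partitions_of_def)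
    with rem[of \<mu>] have "size (?rem \<mu>) \<le> k" "add_column k (?rem \<mu>) = \<mu>" by auto
    with sum_add_column[of "?rem \<mu>" k] \<mu>
    show "?rem \<mu> \<in> partitions_of (n - k) \<and> size (?rem \<mu>) \<le> k"
      by (auto simp: partitions_of_def)
  qed
qed

text \<open>
  The index \<open>j\<close> is the length of the second column of the partition, so the part 1 has
  multiplicity \<open>k - j\<close>. For the symplectic type, this multiplicity has to be even. The power of
  \<open>t\<close> is the contribution of the first column.
\<close>

lemma weight_sum_rec:
  assumes "0 < k" "k \<le> n"
  shows "weight_sum t b n k = t ^ ((k + of_bool (\<not> b)) choose 2) *
     (\<Sum>j\<le>k. if b \<or> even (k - j)
             then weight_sum t (\<not> b) (n - k) j / qfact (t\<^sup>2) ((k - j) div 2) else 0)"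
proof -
  let ?A = "{\<mu> \<in> partitions_of (n - k). size \<mu> \<le> k}"
  let ?w = "\<lambda>b \<mu>. if admissible b \<mu> then t ^ col_exp b \<mu> / mult_prod (t\<^sup>2) \<mu> else 0"
  let ?c = "t ^ ((k + of_bool (\<not> b)) choose 2)"
  let ?d = "\<lambda>j. if b \<or> even (k - j) then 1 / qfact (t\<^sup>2) ((k - j) div 2) else 0"
  have W: "weight_sum t b n k = (\<Sum>\<mu>\<in>parts_level n k. ?w b \<mu>)" for b n k
    unfolding weight_sum_def by (subst sum.inter_filter[symmetric]) auto
  have "weight_sum t b n k = (\<Sum>\<mu>\<in>?A. ?w b (add_column k \<mu>))"
    unfolding W by (rule sum.reindex_bij_betw[symmetric, OF bij_betw_add_column[OF assms(2)]])
  also have "\<dots> = (\<Sum>\<mu>\<in>?A. ?c * (?d (size \<mu>) * ?w (\<not> b) \<mu>))"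
    using assms(1) by (intro sum.cong refl)
      (auto simp: partitions_of_def admissible_add_column col_exp_add_column
         mult_prod_add_column power_add)
  also have "\<dots> = ?c * (\<Sum>\<mu>\<in>?A. ?d (size \<mu>) * ?w (\<not> b) \<mu>)"
    by (rule sum_distrib_left[symmetric])
  also have "(\<Sum>\<mu>\<in>?A. ?d (size \<mu>) * ?w (\<not> b) \<mu>)
      = (\<Sum>j\<le>k. \<Sum>\<mu> | \<mu> \<in> ?A \<and> size \<mu> = j. ?d (size \<mu>) * ?w (\<not> b) \<mu>)"
    using finite_partitions_of by (intro sum.group[symmetric]) auto
  also have "\<dots> = (\<Sum>j\<le>k. ?d j * weight_sum t (\<not> b) (n - k) j)"
  proof (rule sum.cong[OF refl])
    fix j assume "j \<in> {..k}"
    then have "{\<mu>. \<mu> \<in> ?A \<and> size \<mu> = j} = parts_level (n - k) j"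
      by (auto simp: parts_level_def)
    then show "(\<Sum>\<mu> | \<mu> \<in> ?A \<and> size \<mu> = j. ?d (size \<mu>) * ?w (\<not> b) \<mu>)
        = ?d j * weight_sum t (\<not> b) (n - k) j"
      unfolding W sum_distrib_left by (intro sum.cong) (auto simp: parts_level_def)
  qed
  also have "\<dots> = (\<Sum>j\<le>k. if b \<or> even (k - j)
             then weight_sum t (\<not> b) (n - k) j / qfact (t\<^sup>2) ((k - j) div 2) else 0)"
    by (intro sum.cong refl) auto
  finally show ?thesis .
qed

section \<open>Product formulas for a given number of parts\<close>

lemma weight_sum_0: "weight_sum t b n 0 = (if n = 0 then 1 else 0)"
proof -
  have "{\<mu>. \<mu> \<in> parts_level n 0 \<and> admissible b \<mu>} = (if n = 0 then {{#}} else {})"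
    by (auto simp: parts_level_0 admissible_def)
  then show ?thesis
    by (simp add: weight_sum_def col_exp_def mult_prod_def)
qed

lemma weight_sum_eq_0: "n < k \<Longrightarrow> weight_sum t b n k = 0"
  by (simp add: weight_sum_def parts_level_empty)

text \<open>
  The even parts contribute an even number of parts, and the number of odd parts has the parity
  of \<open>n\<close>.
\<close>

lemma weight_sum_True_parity:
  assumes "even n \<noteq> even k"
  shows "weight_sum t True n k = 0"
proof -
  have "even (size \<mu>) = even (sum_mset \<mu>)" if "admissible True \<mu>" for \<mu>
  proof -
    have "even (size {# i \<in># \<mu>. even i #})"
      unfolding size_multiset_overloaded_eq
      using that by (intro dvd_sum) (auto simp: admissible_def)
    moreover have "size \<mu> = size {# i \<in># \<mu>. even i #} + odd_parts \<mu>"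
      unfolding odd_parts_def size_union[symmetric] by (simp flip: multiset_partition)
    ultimately show ?thesis using even_odd_parts_iff[of \<mu>] by simp
  qed
  then have "{\<mu>. \<mu> \<in> parts_level n k \<and> admissible True \<mu>} = {}"
    using assms by (auto simp: parts_level_def partitions_of_def)
  then show ?thesis by (simp only: weight_sum_def sum.empty)
qed

lemma sum_pairs_odd:
  fixes f :: "nat \<Rightarrow> 'a::comm_monoid_add"
  shows "(\<Sum>j\<le>2 * h + 1. f j) = (\<Sum>i\<le>h. f (2 * i) + f (2 * i + 1))"
  by (induction h) (simp_all add: ac_simps)

lemma sum_pairs_even:
  fixes f :: "nat \<Rightarrow> 'a::comm_monoid_add"
  shows "(\<Sum>j\<le>2 * h + 2. f j) = f 0 + (\<Sum>i\<le>h. f (2 * i + 1) + f (2 * i + 2))"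
  by (induction h) (simp_all add: ac_simps numeral_2_eq_2)

lemma choose_two_odd: "(2 * h + 1) choose 2 = h + 2 * (h * h)"
  by (simp add: choose_two algebra_simps)

lemma choose_two_even: "(2 * h + 2) choose 2 = (h + 1) + 2 * (h * (h + 1))"
proof -
  have "(2 * h + 2) * (2 * h + 2 - 1) = 2 * ((h + 1) + 2 * (h * (h + 1)))"
    by (simp add: algebra_simps)
  then show ?thesis unfolding choose_two by simp
qed

text \<open>
  In each of the four recurrences the terms pair up by equal values of \<open>(k - j) div 2\<close>, and every
  pair adds up to a term of \<open>column_sum\<close>. For the orthogonal type this needs two sums of the
  symplectic type, at the same size \<open>2 N\<close>: those with \<open>2 i - 1\<close> and \<open>2 i\<close> parts combine by
  \<open>(1 - Q ^ i) + Q ^ i = 1\<close>, those with \<open>2 i\<close> and \<open>2 i + 1\<close> parts by the Pascal rule. For the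
  symplectic type the condition that \<open>k - j\<close> is even leaves one term of each pair.
\<close>

lemma weight_sum_closed:
  fixes t :: "'a::field"
  assumes nz: "\<forall>k>0. (t\<^sup>2) ^ k \<noteq> 1"
  defines "Q \<equiv> t\<^sup>2"
  shows "weight_sum t True (2 * m + 1) (2 * h + 1) = t ^ m * Q ^ (h * h) * qbinom Q m h / qfact Q h"
    and "weight_sum t True (2 * m + 2) (2 * h + 2)
         = t ^ (m + 1) * Q ^ (h * (h + 1)) * qbinom Q m h / qfact Q (h + 1)"
    and "weight_sum t False (2 * m + 2) (2 * h + 1)
         = t ^ (m + 1) * Q ^ (h * (h + 1)) * qbinom Q m h / qfact Q h"
    and "weight_sum t False (2 * m + 2) (2 * h + 2)
         = t ^ (m + 1) * Q ^ ((h + 1) * (h + 1)) * qbinom Q m h / qfact Q (h + 1)"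
proof (induction m arbitrary: h rule: less_induct)
  case (less m)
  note nzQ = nz[folded Q_def]
  note nzf = qfact_nonzero[OF nzQ]
  have tQ: "t ^ (a + 2 * b) = t ^ a * Q ^ b" for a b
    by (simp add: Q_def power_add power_mult)
  have True_odd: "weight_sum t True (2 * m + 1) (2 * h + 1)
      = t ^ m * Q ^ (h * h) * qbinom Q m h / qfact Q h" for h
  proof (cases "h \<le> m")
    case False
    then show ?thesis by (simp add: weight_sum_eq_0 qbinom_eq_0)
  next
    case True
    define N where "N = m - h"
    have m: "m = N + h" using True by (simp add: N_def)
    have "weight_sum t True (2 * m + 1) (2 * h + 1)
        = t ^ ((2 * h + 1) choose 2) *
          (\<Sum>j\<le>2 * h + 1. weight_sum t False (2 * N) j / qfact Q ((2 * h + 1 - j) div 2))"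
      using m by (subst weight_sum_rec) (simp_all add: Q_def)
    also have "(\<Sum>j\<le>2 * h + 1. weight_sum t False (2 * N) j / qfact Q ((2 * h + 1 - j) div 2))
        = (\<Sum>i\<le>h. (weight_sum t False (2 * N) (2 * i) + weight_sum t False (2 * N) (2 * i + 1))
              / qfact Q (h - i))"
      unfolding sum_pairs_odd
    proof (rule sum.cong[OF refl])
      fix i assume "i \<in> {..h}"
      then have "(2 * h + 1 - 2 * i) div 2 = h - i" "(2 * h + 1 - (2 * i + 1)) div 2 = h - i" by auto
      then show "weight_sum t False (2 * N) (2 * i) / qfact Q ((2 * h + 1 - 2 * i) div 2) +
          weight_sum t False (2 * N) (2 * i + 1) / qfact Q ((2 * h + 1 - (2 * i + 1)) div 2)
        = (weight_sum t False (2 * N) (2 * i) + weight_sum t False (2 * N) (2 * i + 1))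
              / qfact Q (h - i)"
        by (simp only: add_divide_distrib)
    qed
    also have "\<dots> = (\<Sum>i\<le>h. t ^ N * (Q ^ (i * (i + 0)) * qbinom Q N i / (qfact Q (i + 0) * qfact Q (h - i))))"
    proof (rule sum.cong[OF refl])
      fix i
      have "weight_sum t False (2 * N) (2 * i) + weight_sum t False (2 * N) (2 * i + 1)
          = t ^ N * Q ^ (i * i) * qbinom Q N i / qfact Q i"
      proof (cases N)
        case 0
        then show ?thesis by (cases i) (simp_all add: weight_sum_0 weight_sum_eq_0)
      next
        case (Suc N')
        with m have lt: "N' < m" by simp
        have N2: "2 * N = 2 * N' + 2" using Suc by simp
        have second: "weight_sum t False (2 * N) (2 * i + 1)
            = t ^ N * Q ^ (i * (i + 1)) * qbinom Q N' i / qfact Q i" for i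
          unfolding N2 less.IH(3)[OF lt] by (simp add: Suc)
        show ?thesis
        proof (cases i)
          case 0
          then show ?thesis using second[of 0] by (simp add: weight_sum_0 Suc)
        next
          case i: (Suc l)
          have "weight_sum t False (2 * N) (2 * i) = weight_sum t False (2 * N' + 2) (2 * l + 2)"
            unfolding N2 i by simp
          also have "\<dots> = t ^ N * Q ^ (i * i) * qbinom Q N' l / qfact Q i"
            unfolding less.IH(4)[OF lt] by (simp add: Suc i)
          finally show ?thesis unfolding second using Suc i
            by (simp add: add_divide_distrib[symmetric] power_add algebra_simps)
        qed
      qed
      then show "(weight_sum t False (2 * N) (2 * i) + weight_sum t False (2 * N) (2 * i + 1)) / qfact Q (h - i)
          = t ^ N * (Q ^ (i * (i + 0)) * qbinom Q N i / (qfact Q (i + 0) * qfact Q (h - i)))"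
        by simp
    qed
    also have "\<dots> = t ^ N * (qbinom Q m h / qfact Q h)"
      unfolding sum_distrib_left[symmetric] column_sum[OF nzQ] using m by simp
    finally show ?thesis
      unfolding choose_two_odd tQ using m by (simp add: power_add algebra_simps)
  qed
  \<comment> \<open>The recurrences for an even number of parts, for both types at once: \<open>P\<close> is the flag of the
      type, so the terms with odd \<open>k - j\<close> drop out when it is false, and \<open>f\<close> stands for the sums
      of the other type.\<close>
  have pair_terms: "(\<Sum>j\<le>2 * h + 2. if P \<or> even (2 * h + 2 - j)
        then f j / qfact Q ((2 * h + 2 - j) div 2) else 0)
      = f 0 / qfact Q (h + 1)
        + (\<Sum>i\<le>h. ((if P then f (2 * i + 1) else 0) + f (2 * i + 2)) / qfact Q (h - i))"
    for f :: "nat \<Rightarrow> 'a" and P h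
    unfolding sum_pairs_even
  proof (intro arg_cong2[of _ _ _ _ "(+)"] sum.cong refl)
    fix i assume "i \<in> {..h}"
    then have "2 * h + 2 - (2 * i + 1) = 2 * (h - i) + 1" "2 * h + 2 - (2 * i + 2) = 2 * (h - i)"
      by auto
    then show "(if P \<or> even (2 * h + 2 - (2 * i + 1))
           then f (2 * i + 1) / qfact Q ((2 * h + 2 - (2 * i + 1)) div 2) else 0) +
          (if P \<or> even (2 * h + 2 - (2 * i + 2))
           then f (2 * i + 2) / qfact Q ((2 * h + 2 - (2 * i + 2)) div 2) else 0)
        = ((if P then f (2 * i + 1) else 0) + f (2 * i + 2)) / qfact Q (h - i)"
      by (simp add: add_divide_distrib)
  qed simp
  \<comment> \<open>For \<open>m = h\<close> only the empty partition is left after removing the column; it has to be kept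
      apart because the product formulas do not cover size 0.\<close>
  have even_case: "(f 0 / qfact Q (h + 1)
        + (\<Sum>i\<le>h. ((if P then f (2 * i + 1) else 0) + f (2 * i + 2)) / qfact Q (h - i)))
      = t ^ (m - h) * qbinom Q m h / qfact Q (h + 1)"
    if "h \<le> m"
      and f0: "\<And>k. m = h \<Longrightarrow> f k = (if k = 0 then 1 else 0)"
      and f1: "\<And>N i. m = Suc N + h \<Longrightarrow> f 0 = 0 \<and>
        (if P then f (2 * i + 1) else 0) + f (2 * i + 2)
          = t ^ Suc N * Q ^ (i * (i + 1)) * qbinom Q N i / qfact Q (i + 1)"
    for f :: "nat \<Rightarrow> 'a" and P h
  proof (cases "m - h")
    case 0
    with that(1) have "m = h" by simp
    then show ?thesis using f0 by (auto intro!: sum.neutral)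
  next
    case (Suc N)
    with that(1) have m: "m = Suc N + h" by simp
    have "f 0 / qfact Q (h + 1)
        + (\<Sum>i\<le>h. ((if P then f (2 * i + 1) else 0) + f (2 * i + 2)) / qfact Q (h - i))
      = (\<Sum>i\<le>h. t ^ Suc N * (Q ^ (i * (i + 1)) * qbinom Q N i / (qfact Q (i + 1) * qfact Q (h - i))))"
      using f1[OF m] by (simp add: mult.assoc)
    also have "\<dots> = t ^ Suc N * (qbinom Q (N + h + 1) h / qfact Q (h + 1))"
      unfolding sum_distrib_left[symmetric] column_sum[OF nzQ] ..
    finally show ?thesis using m by simp
  qed
  have True_even: "weight_sum t True (2 * m + 2) (2 * h + 2)
      = t ^ (m + 1) * Q ^ (h * (h + 1)) * qbinom Q m h / qfact Q (h + 1)" for h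
  proof (cases "h \<le> m")
    case False
    then show ?thesis by (simp add: weight_sum_eq_0 qbinom_eq_0)
  next
    case True
    let ?f = "weight_sum t False (2 * (m - h))"
    have "weight_sum t True (2 * m + 2) (2 * h + 2)
        = t ^ ((2 * h + 2) choose 2) * (\<Sum>j\<le>2 * h + 2. if True \<or> even (2 * h + 2 - j)
            then ?f j / qfact Q ((2 * h + 2 - j) div 2) else 0)"
      using True by (subst weight_sum_rec) (simp_all add: Q_def diff_mult_distrib2)
    also have "\<dots> = t ^ ((2 * h + 2) choose 2) * (t ^ (m - h) * qbinom Q m h / qfact Q (h + 1))"
      unfolding pair_terms
    proof (subst even_case[OF True])
      show "?f k = (if k = 0 then 1 else 0)" if "m = h" for k
        using that by (simp add: weight_sum_0 weight_sum_eq_0)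
      fix N i assume m: "m = Suc N + h"
      then have N2: "2 * (m - h) = 2 * N + 2" and lt: "N < m" by auto
      have "1 / qfact Q i = (1 - Q ^ (i + 1)) / qfact Q (i + 1)"
        using nzf nzQ[rule_format, of "i + 1"] by (simp add: qfact_Suc)
      then have "?f (2 * i + 1)
          = t ^ (N + 1) * Q ^ (i * (i + 1)) * qbinom Q N i * ((1 - Q ^ (i + 1)) / qfact Q (i + 1))"
        unfolding N2 less.IH(3)[OF lt] by (metis divide_inverse inverse_eq_divide)
      then show "?f 0 = 0 \<and> (if True then ?f (2 * i + 1) else 0) + ?f (2 * i + 2)
          = t ^ Suc N * Q ^ (i * (i + 1)) * qbinom Q N i / qfact Q (i + 1)"
        unfolding N2 less.IH(4)[OF lt]
        by (simp add: weight_sum_0 add_divide_distrib[symmetric] power_add algebra_simps)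
    qed simp
    finally show ?thesis
      unfolding choose_two_even tQ using True by (simp add: power_add[symmetric])
  qed
  have False_even: "weight_sum t False (2 * m + 2) (2 * h + 2)
      = t ^ (m + 1) * Q ^ ((h + 1) * (h + 1)) * qbinom Q m h / qfact Q (h + 1)" for h
  proof (cases "h \<le> m")
    case False
    then show ?thesis by (simp add: weight_sum_eq_0 qbinom_eq_0)
  next
    case True
    let ?f = "weight_sum t True (2 * (m - h))"
    have "weight_sum t False (2 * m + 2) (2 * h + 2)
        = t ^ ((2 * (h + 1) + 1) choose 2) * (\<Sum>j\<le>2 * h + 2. if False \<or> even (2 * h + 2 - j)
            then ?f j / qfact Q ((2 * h + 2 - j) div 2) else 0)"
      using True
      by (subst weight_sum_rec) (simp_all add: Q_def diff_mult_distrib2 cong: if_cong)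
    also have "\<dots> = t ^ ((2 * (h + 1) + 1) choose 2) * (t ^ (m - h) * qbinom Q m h / qfact Q (h + 1))"
      unfolding pair_terms
    proof (subst even_case[OF True])
      show "?f k = (if k = 0 then 1 else 0)" if "m = h" for k
        using that by (simp add: weight_sum_0 weight_sum_eq_0)
      fix N i assume m: "m = Suc N + h"
      then have N2: "2 * (m - h) = 2 * N + 2" and lt: "N < m" by auto
      show "?f 0 = 0 \<and> (if False then ?f (2 * i + 1) else 0) + ?f (2 * i + 2)
          = t ^ Suc N * Q ^ (i * (i + 1)) * qbinom Q N i / qfact Q (i + 1)"
        unfolding N2 less.IH(2)[OF lt] by (simp add: weight_sum_0)
    qed simp
    finally show ?thesis
      unfolding choose_two_odd tQ using True by (simp add: power_add[symmetric])
  qed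
  have False_odd: "weight_sum t False (2 * m + 2) (2 * h + 1)
      = t ^ (m + 1) * Q ^ (h * (h + 1)) * qbinom Q m h / qfact Q h" for h
  proof (cases "h \<le> m")
    case False
    then show ?thesis by (simp add: weight_sum_eq_0 qbinom_eq_0)
  next
    case True
    define N where "N = m - h"
    have m: "m = N + h" using True by (simp add: N_def)
    \<comment> \<open>For \<open>h = 0\<close> the size only drops from \<open>2 m + 2\<close> to \<open>2 m + 1\<close>; hence the odd case at the
        same \<open>m\<close> was settled first.\<close>
    have N: "weight_sum t True (2 * N + 1) (2 * i + 1)
        = t ^ N * Q ^ (i * i) * qbinom Q N i / qfact Q i" for i
      using True_odd less.IH(1)[of N] m by (cases "h = 0") auto
    have "weight_sum t False (2 * m + 2) (2 * h + 1)
        = t ^ ((2 * h + 2) choose 2) * (\<Sum>j\<le>2 * h + 1. if even (2 * h + 1 - j)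
            then weight_sum t True (2 * N + 1) j / qfact Q ((2 * h + 1 - j) div 2) else 0)"
      using m by (subst weight_sum_rec) (simp_all add: Q_def cong: if_cong)
    also have "(\<Sum>j\<le>2 * h + 1. if even (2 * h + 1 - j)
            then weight_sum t True (2 * N + 1) j / qfact Q ((2 * h + 1 - j) div 2) else 0)
        = (\<Sum>i\<le>h. t ^ N * (Q ^ (i * (i + 0)) * qbinom Q N i / (qfact Q (i + 0) * qfact Q (h - i))))"
      unfolding sum_pairs_odd
    proof (rule sum.cong[OF refl])
      fix i assume "i \<in> {..h}"
      then have "2 * h + 1 - 2 * i = 2 * (h - i) + 1" "2 * h + 1 - (2 * i + 1) = 2 * (h - i)" by auto
      then show "(if even (2 * h + 1 - 2 * i)
            then weight_sum t True (2 * N + 1) (2 * i) / qfact Q ((2 * h + 1 - 2 * i) div 2) else 0)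
         + (if even (2 * h + 1 - (2 * i + 1))
            then weight_sum t True (2 * N + 1) (2 * i + 1) / qfact Q ((2 * h + 1 - (2 * i + 1)) div 2) else 0)
         = t ^ N * (Q ^ (i * (i + 0)) * qbinom Q N i / (qfact Q (i + 0) * qfact Q (h - i)))"
        using N[of i] by simp
    qed
    also have "\<dots> = t ^ N * (qbinom Q m h / qfact Q h)"
      unfolding sum_distrib_left[symmetric] column_sum[OF nzQ] using m by simp
    finally show ?thesis
      unfolding choose_two_even tQ using m by (simp add: power_add algebra_simps)
  qed
  show "weight_sum t True (2 * m + 1) (2 * h + 1) = t ^ m * Q ^ (h * h) * qbinom Q m h / qfact Q h" for h
    by (rule True_odd)
  show "weight_sum t True (2 * m + 2) (2 * h + 2)
         = t ^ (m + 1) * Q ^ (h * (h + 1)) * qbinom Q m h / qfact Q (h + 1)" for h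
    by (rule True_even)
  show "weight_sum t False (2 * m + 2) (2 * h + 1)
         = t ^ (m + 1) * Q ^ (h * (h + 1)) * qbinom Q m h / qfact Q h" for h
    by (rule False_odd)
  show "weight_sum t False (2 * m + 2) (2 * h + 2)
         = t ^ (m + 1) * Q ^ ((h + 1) * (h + 1)) * qbinom Q m h / qfact Q (h + 1)" for h
    by (rule False_even)
qed

section \<open>The weighted partition sum\<close>

text \<open>
  The number of odd parts is the alternating sum of the column lengths, because a part \<open>x\<close>
  contributes \<open>1 - 1 + 1 - \<dots>\<close> with \<open>x\<close> terms.
\<close>

lemma two_col_exp: "2 * int (col_exp True \<mu>)
    = (\<Sum>i = 1..sum_mset \<mu>. int (conj_part \<mu> i) ^ 2) - int (odd_parts \<mu>)"
proof -
  have odd_parts: "int (odd_parts \<mu>) = (\<Sum>i = 1..N. if odd i then int (conj_part \<mu> i) else - int (conj_part \<mu> i))"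
    if "sum_mset \<mu> \<le> N" for N
    using that
  proof (induction \<mu>)
    case empty
    then show ?case by (auto simp: odd_parts_def conj_part_def intro!: sum.neutral)
  next
    case (add x \<mu>)
    have alt: "(\<Sum>i = 1..x. if odd i then 1 else - 1) = (if odd x then 1 else 0 :: int)"
      by (induction x) auto
    let ?s = "\<lambda>i. if odd i then 1 else - 1 :: int"
    have "(\<Sum>i = 1..N. if odd i then int (conj_part (add_mset x \<mu>) i) else - int (conj_part (add_mset x \<mu>) i))
        = (\<Sum>i = 1..N. (if odd i then int (conj_part \<mu> i) else - int (conj_part \<mu> i))
            + (if i \<le> x then ?s i else 0))"
      by (intro sum.cong) (auto simp: conj_part_eq_size)
    also have "\<dots> = int (odd_parts \<mu>) + (\<Sum>i = 1..N. if i \<le> x then ?s i else 0)"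
      using add by (simp only: sum.distrib) simp
    also have "(\<Sum>i = 1..N. if i \<le> x then ?s i else 0) = (\<Sum>i = 1..x. ?s i)"
      using add.prems by (intro sum.mono_neutral_cong_right) auto
    finally show ?case unfolding alt by (simp add: odd_parts_def)
  qed
  have ch: "2 * int (n choose 2) = int n ^ 2 - int n" for n
  proof -
    have "2 * (n choose 2) = n * (n - 1)" by (cases n) (simp_all add: choose_two)
    then have "2 * int (n choose 2) = int (n * (n - 1))" by (metis of_nat_mult of_nat_numeral)
    then show ?thesis by (cases n) (simp_all add: power2_eq_square algebra_simps)
  qed
  have "2 * int (col_exp True \<mu>) = (\<Sum>i = 1..sum_mset \<mu>. int (conj_part \<mu> i) ^ 2
      - (if odd i then int (conj_part \<mu> i) else - int (conj_part \<mu> i)))"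
    unfolding col_exp_def of_nat_sum sum_distrib_left ch
    by (intro sum.cong) (auto simp: power2_eq_square algebra_simps)
  then show ?thesis
    using odd_parts[of "sum_mset \<mu>"] by (simp add: sum_subtractf)
qed

lemma half_exponent_eq: "half_exponent \<mu> = int (col_exp True \<mu>)"
  unfolding half_exponent_def two_col_exp[symmetric] by simp

text \<open>
  The factor \<open>1 - t ^ (2 * h + 2) = 1 - Q ^ (h + 1)\<close> cancels the last factor of the denominator
  \<open>(Q)_(h + 1)\<close> of the product formula, which leaves the sum evaluated in \<open>alternating_sum\<close>.
\<close>

lemma weighted_partition_sum:
  fixes t :: "'a::field"
  assumes nz: "\<forall>k>0. (t\<^sup>2) ^ k \<noteq> 1"
  shows "(\<Sum>\<mu> | \<mu> \<in> partitions_of (2 * M + 2) \<and> admissible True \<mu>.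
            (1 - t ^ size \<mu>) * (t ^ col_exp True \<mu> / mult_prod (t\<^sup>2) \<mu>))
       = t ^ (M + 1) * (\<Sum>i\<le>M. (- 1) ^ i * (t\<^sup>2) ^ (Suc i choose 2) / qfact (t\<^sup>2) (M - i))"
proof -
  define Q where "Q = t\<^sup>2"
  note nzQ = nz[folded Q_def]
  let ?A = "{\<mu>. \<mu> \<in> partitions_of (2 * M + 2) \<and> admissible True \<mu>}"
  let ?w = "\<lambda>\<mu>. t ^ col_exp True \<mu> / mult_prod Q \<mu>"
  have "size \<mu> \<le> 2 * M + 2" if "\<mu> \<in> partitions_of (2 * M + 2)" for \<mu>
    using size_le_sum_mset[of \<mu>] that by (simp add: partitions_of_def)
  then have "(\<Sum>\<mu>\<in>?A. (1 - t ^ size \<mu>) * ?w \<mu>)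
      = (\<Sum>k\<le>2 * M + 2. \<Sum>\<mu> | \<mu> \<in> ?A \<and> size \<mu> = k. (1 - t ^ size \<mu>) * ?w \<mu>)"
    using finite_partitions_of by (intro sum.group[symmetric]) auto
  also have "\<dots> = (\<Sum>k\<le>2 * M + 2. (1 - t ^ k) * weight_sum t True (2 * M + 2) k)"
    unfolding weight_sum_def sum_distrib_left Q_def
    by (intro sum.cong refl) (auto simp: parts_level_def)
  also have "\<dots> = (\<Sum>h\<le>M. (1 - t ^ (2 * h + 2)) * weight_sum t True (2 * M + 2) (2 * h + 2))"
    unfolding sum_pairs_even by (simp add: weight_sum_True_parity)
  also have "\<dots> = (\<Sum>h\<le>M. t ^ (M + 1) * (Q ^ (h * (h + 1)) * qbinom Q M h / qfact Q h))"
  proof (rule sum.cong[OF refl])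
    fix h
    have "t ^ (2 * h + 2) = Q ^ (h + 1)"
      by (simp add: Q_def power_add power_mult power2_eq_square)
    then show "(1 - t ^ (2 * h + 2)) * weight_sum t True (2 * M + 2) (2 * h + 2)
        = t ^ (M + 1) * (Q ^ (h * (h + 1)) * qbinom Q M h / qfact Q h)"
      unfolding weight_sum_closed(2)[OF nz, folded Q_def]
      using nzQ[rule_format, of "h + 1"] by (simp add: qfact_Suc del: power_Suc)
  qed
  also have "\<dots> = t ^ (M + 1) * (\<Sum>i\<le>M. (- 1) ^ i * Q ^ (Suc i choose 2) / qfact Q (M - i))"
    unfolding sum_distrib_left[symmetric] alternating_sum[OF nzQ] ..
  finally show ?thesis unfolding Q_def .
qed

lemma qvar_power: "qvar ^ k = Fract (monom 1 k) 1"
proof -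
  have "[:0, 1:] = monom (1::rat) 1" by (simp add: monom_altdef)
  then show ?thesis
    unfolding qvar_def by (induction k) (auto simp: One_fract_def mult_monom)
qed

lemma qvar_power_neq_1: "k > 0 \<Longrightarrow> qvar ^ k \<noteq> 1"
proof
  assume "k > 0" "qvar ^ k = 1"
  then have "monom (1::rat) k = 1"
    by (simp add: qvar_power One_fract_def eq_fract)
  then have "degree (monom (1::rat) k) = 0" by simp
  with \<open>k > 0\<close> show False by (simp add: degree_monom_eq)
qed

theorem mainTheorem3:
  fixes m :: nat
  assumes "m \<ge> 1"
  shows "(\<Sum>\<mu> | \<mu> \<in> partitions_of (2 * m) \<and> (\<forall>i. even i \<longrightarrow> even (count \<mu> i)).
            (1 - qvar powi (- int (conj_part \<mu> 1))) /
            (qvar powi half_exponent \<mu> *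
              (\<Prod>i\<in>set_mset \<mu>. qpochhammer (1 / qvar ^ 2) (1 / qvar ^ 2) (count \<mu> i div 2))))
         = 1 / qvar ^ m *
            (\<Sum>i = 1..m. (- 1) ^ (i - 1) /
               (qvar ^ (i * (i - 1)) * qpochhammer (1 / qvar ^ 2) (1 / qvar ^ 2) (m - i)))"
proof -
  define t where "t = 1 / qvar"
  obtain M where M: "m = M + 1" using assms by (metis le_add_diff_inverse2)
  have t_pow: "t ^ k = 1 / qvar ^ k" for k by (simp add: t_def power_one_over)
  have nz: "\<forall>k>0. (t\<^sup>2) ^ k \<noteq> 1"
  proof (intro allI impI)
    fix k :: nat assume "k > 0"
    then have "qvar ^ (2 * k) \<noteq> 1" by (intro qvar_power_neq_1) simp
    moreover have "(t\<^sup>2) ^ k = 1 / qvar ^ (2 * k)"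
      by (metis power_mult t_pow)
    ultimately show "(t\<^sup>2) ^ k \<noteq> 1" by simp
  qed
  have "(\<Sum>\<mu> | \<mu> \<in> partitions_of (2 * m) \<and> (\<forall>i. even i \<longrightarrow> even (count \<mu> i)).
            (1 - qvar powi (- int (conj_part \<mu> 1))) /
            (qvar powi half_exponent \<mu> *
              (\<Prod>i\<in>set_mset \<mu>. qpochhammer (1 / qvar ^ 2) (1 / qvar ^ 2) (count \<mu> i div 2))))
      = (\<Sum>\<mu> | \<mu> \<in> partitions_of (2 * M + 2) \<and> admissible True \<mu>.
            (1 - t ^ size \<mu>) * (t ^ col_exp True \<mu> / mult_prod (t\<^sup>2) \<mu>))"
  proof (rule sum.cong)
    fix \<mu> assume "\<mu> \<in> {\<mu>. \<mu> \<in> partitions_of (2 * M + 2) \<and> admissible True \<mu>}"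
    then have "conj_part \<mu> 1 = size \<mu>"
      by (intro conj_part_1) (simp add: partitions_of_def)
    then show "(1 - qvar powi (- int (conj_part \<mu> 1))) /
            (qvar powi half_exponent \<mu> *
              (\<Prod>i\<in>set_mset \<mu>. qpochhammer (1 / qvar ^ 2) (1 / qvar ^ 2) (count \<mu> i div 2)))
        = (1 - t ^ size \<mu>) * (t ^ col_exp True \<mu> / mult_prod (t\<^sup>2) \<mu>)"
      by (simp add: half_exponent_eq mult_prod_def t_pow power_int_minus inverse_eq_divide)
  qed (simp add: M admissible_def)
  also have "\<dots> = t ^ (M + 1) * (\<Sum>i\<le>M. (- 1) ^ i * (t\<^sup>2) ^ (Suc i choose 2) / qfact (t\<^sup>2) (M - i))"
    by (rule weighted_partition_sum[OF nz])
  also have "(\<Sum>i\<le>M. (- 1) ^ i * (t\<^sup>2) ^ (Suc i choose 2) / qfact (t\<^sup>2) (M - i))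
      = (\<Sum>i = 1..m. (- 1) ^ (i - 1) /
               (qvar ^ (i * (i - 1)) * qpochhammer (1 / qvar ^ 2) (1 / qvar ^ 2) (m - i)))"
  proof (rule sum.reindex_bij_witness[of _ "\<lambda>i. i - 1" Suc])
    fix i assume "i \<in> {..M}"
    have "2 * (Suc i choose 2) = Suc i * i" by (simp add: choose_two)
    then have "(t\<^sup>2) ^ (Suc i choose 2) = 1 / qvar ^ (Suc i * i)"
      by (metis power_mult t_pow)
    then show "(- 1) ^ (Suc i - 1) /
               (qvar ^ (Suc i * (Suc i - 1)) * qpochhammer (1 / qvar ^ 2) (1 / qvar ^ 2) (m - Suc i))
        = (- 1) ^ i * (t\<^sup>2) ^ (Suc i choose 2) / qfact (t\<^sup>2) (M - i)"
      by (simp add: M t_pow)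
  qed (auto simp: M)
  finally show ?thesis unfolding M[symmetric] t_pow .
qed

end
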